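(* Let $l\in(0,\pi]$, let $m^+,m^-$ be probability measures on $[0,1]$ with mean $\frac12$, and let $(K^{m^+,m^-},W)$ be the flow of kernels on $\mathscr C$ and Brownian motion constructed in the context. Then almost surely, $$\forall z\in\mathscr C,\ \forall t\ge0,\qquad \operatorname{Card}\operatorname{supp}\big(K^{m^+,m^-}_{0,t}(z)\big)<\infty .$$
   Context: $\mathscr C=\{z\in\mathbb C:|z|=1\}$; $\arg(z)\in[0,2\pi)$; $\epsilon(z)=1$ if $\arg(z)\in[0,l]$ and $\epsilon(z)=-1$ if $\arg(z)\in(l,2\pi)$. Kernels on $\mathscr C$ are measurable maps $\mathscr C\to\mathcal P(\mathscr C)$, composed by $K_1K_2(x)=\int K_1(x,dy)K_2(y)$. Construction of $(K^{m^+,m^-},W)$. By Kolmogorov's extension theorem take a process $(U^+_{s,t},U^-_{s,t},W_{s,t})_{s\le t}$ with values in $[0,1]^2\times\mathbb R$ such that: (i) $W_{s,t}=W_t-W_s$ with $W$ a Brownian motion on $\mathbb R$ (i.e. $(W_t)_{t\ge0}$, $(W_{-t})_{t\ge0}$ are independent standard Brownian motions); (ii) given $W$, $(U^+_{s,t})_{s\le t}$ and $(U^-_{s,t})_{s\le t}$ are independent; (iii) for fixed $s<t$, $U^\pm_{s,t}$ is independent of $W$ with law $m^\pm$; (iv) with $M^+_{s,t}=\inf_{u\in[s,t]}W_u$ and $M^-_{s,t}=\sup_{u\in[s,t]}W_u$, for all $s<t$, $u<v$: $U^\pm_{s,t}=U^\pm_{u,v}$ a.s. on $\{M^\pm_{s,t}=M^\pm_{u,v}\}$;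 (v) for $s<t$ and $s_i<t_i$ ($1\le i\le n$), the law of $U^\pm_{s,t}$ given $(U^\pm_{s_i,t_i})_{i\le n}$ and $W$ is $m^\pm$ when $M^\pm_{s,t}\notin\{M^\pm_{s_i,t_i}:1\le i\le n\}$, and is $\delta_{U^\pm_{s_i,t_i}}$ on $\{M^\pm_{s,t}=M^\pm_{s_i,t_i}\}$. Then replace $U^\pm_{s,t}$, simultaneously for all $s<t$, by its modification $\limsup_{n\to\infty}U^\pm_{s_n,t_n}$ with $s_n=\frac{\lfloor ns\rfloor+1}{n}$, $t_n=\frac{\lfloor nt\rfloor-1}{n}$, still denoted $U^\pm_{s,t}$. Let $W^+_{s,t}=W_t-\inf_{[s,t]}W$, $W^-_{s,t}=\sup_{[s,t]}W-W_t$, $\rho_s=\inf\{r\ge s:\sup(W^+_{s,r},W^-_{s,r})=l\}$, and $\tau_s(z)=\inf\{r\ge s: ze^{i\epsilon(z)W_{s,r}}\in\{1,e^{il}\}\}$. For $t\in[s,\rho_s]$ set $K_{s,t}(1)=U^+_{s,t}\delta_{\exp(iW^+_{s,t})}+(1-U^+_{s,t})\delta_{\exp(-iW^+_{s,t})}$, $K_{s,t}(e^{il})=U^-_{s,t}\delta_{\exp(i(l+W^-_{s,t}))}+(1-U^-_{s,t})\delta_{\exp(i(l-W^-_{s,t}))}$, and for $z\notin\{1,e^{il}\}$: $K_{s,t}(z)=\delta_{ze^{i\epsilon(z)W_{s,t}}}$ if $t\le\tau_s(z)$, while if $t>\tau_s(z)$, $K_{s,t}(z)=K_{s,t}(1)$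 when $ze^{i\epsilon(z)W_{s,\tau_s(z)}}=1$ and $K_{s,t}(z)=K_{s,t}(e^{il})$ when $ze^{i\epsilon(z)W_{s,\tau_s(z)}}=e^{il}$. With $\rho^0_s=s$, $\rho^{k+1}_s=\rho_{\rho^k_s}$, for all $s\le t$ set $K^{m^+,m^-}_{s,t}=\sum_{k\ge0}1_{\{\rho^k_s\le t<\rho^{k+1}_s\}}K_{s,\rho_s}K_{\rho_s,\rho^2_s}\cdots K_{\rho^{k-1}_s,\rho^k_s}K_{\rho^k_s,t}$. *)

theory Defs
  imports "HOL-Probability.Probability"
begin

section \<open>Spaces\<close>

abbreviation unit_circle :: "complex set" where
  "unit_circle \<equiv> sphere 0 1"

abbreviation circle_space :: "complex measure" where
  "circle_space \<equiv> restrict_space borel unit_circle"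

abbreviation unit_interval :: "real measure" where
  "unit_interval \<equiv> restrict_space borel {0..1}"

abbreviation path_space :: "(real \<Rightarrow> real) measure" where
  "path_space \<equiv> Pi\<^sub>M UNIV (\<lambda>_. borel)"

abbreviation half_path_space :: "(real \<Rightarrow> real) measure" where
  "half_path_space \<equiv> Pi\<^sub>M {0..} (\<lambda>_. borel)"

abbreviation time_pairs :: "(real \<times> real) set" where
  "time_pairs \<equiv> {(s, t). s \<le> t}"

definition measure_supp :: "complex measure \<Rightarrow> complex set" where
  "measure_supp \<mu> = {x \<in> space \<mu>. \<forall>V. open V \<longrightarrow> x \<in> V \<longrightarrow> emeasure \<mu> (V \<inter> space \<mu>) > 0}"

section \<open>Brownian motion\<close>

definition (in prob_space) standard_brownian_motion :: "(real \<Rightarrow> 'a \<Rightarrow> real) \<Rightarrow> bool" where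
  "standard_brownian_motion B \<longleftrightarrow>
    (\<forall>t\<ge>0. B t \<in> borel_measurable M) \<and>
    (\<forall>\<omega>\<in>space M. B 0 \<omega> = 0) \<and>
    (\<forall>\<omega>\<in>space M. continuous_on {0..} (\<lambda>t. B t \<omega>)) \<and>
    (\<forall>s t. 0 \<le> s \<longrightarrow> s < t \<longrightarrow>
      distributed M lborel (\<lambda>\<omega>. B t \<omega> - B s \<omega>) (normal_density 0 (sqrt (t - s)))) \<and>
    (\<forall>(r :: nat \<Rightarrow> real) n. 0 \<le> r 0 \<longrightarrow> (\<forall>i<n. r i < r (Suc i)) \<longrightarrow>
      indep_vars (\<lambda>_. borel) (\<lambda>i \<omega>. B (r (Suc i)) \<omega> - B (r i) \<omega>) {..<n})"

definition (in prob_space) two_sided_brownian_motion :: "(real \<Rightarrow> 'a \<Rightarrow> real) \<Rightarrow> bool" where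
  "two_sided_brownian_motion W \<longleftrightarrow>
    standard_brownian_motion W \<and>
    standard_brownian_motion (\<lambda>t. W (- t)) \<and>
    indep_var half_path_space (\<lambda>\<omega>. \<lambda>t\<in>{0..}. W t \<omega>) half_path_space (\<lambda>\<omega>. \<lambda>t\<in>{0..}. W (- t) \<omega>)"

section \<open>Independence, conditional laws and conditional independence\<close>

text \<open>Independence of two random variables whose values may have different types.\<close>

definition (in prob_space) indep_rvs ::
    "'b measure \<Rightarrow> ('a \<Rightarrow> 'b) \<Rightarrow> 'c measure \<Rightarrow> ('a \<Rightarrow> 'c) \<Rightarrow> bool" where
  "indep_rvs N1 X N2 Y \<longleftrightarrow>
    random_variable N1 X \<and> random_variable N2 Y \<and>
    indep_set {X -` A \<inter> space M | A. A \<in> sets N1} {Y -` B \<inter> space M | B. B \<in> sets N2}"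

definition (in prob_space) cond_indep_var ::
    "'a measure \<Rightarrow> 'b measure \<Rightarrow> ('a \<Rightarrow> 'b) \<Rightarrow> 'c measure \<Rightarrow> ('a \<Rightarrow> 'c) \<Rightarrow> bool" where
  "cond_indep_var G N1 X N2 Y \<longleftrightarrow>
    (\<forall>A\<in>sets N1. \<forall>B\<in>sets N2. AE \<omega> in M.
      real_cond_exp M G (\<lambda>\<omega>'. indicator A (X \<omega>') * indicator B (Y \<omega>')) \<omega> =
      real_cond_exp M G (\<lambda>\<omega>'. indicator A (X \<omega>')) \<omega> *
      real_cond_exp M G (\<lambda>\<omega>'. indicator B (Y \<omega>')) \<omega>)"

text \<open>On the event \<open>E\<close>, the law of \<open>X\<close> given \<open>G\<close> is the random measure \<open>\<kappa>\<close>.\<close>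

definition (in prob_space) cond_law_on ::
    "'a set \<Rightarrow> 'a measure \<Rightarrow> 'b measure \<Rightarrow> ('a \<Rightarrow> 'b) \<Rightarrow> ('a \<Rightarrow> 'b measure) \<Rightarrow> bool" where
  "cond_law_on E G N X \<kappa> \<longleftrightarrow>
    (\<forall>B\<in>sets N. AE \<omega> in M. \<omega> \<in> E \<longrightarrow>
      real_cond_exp M G (\<lambda>\<omega>'. indicator B (X \<omega>')) \<omega> = measure (\<kappa> \<omega>) B)"

section \<open>The driving process\<close>

definition run_inf :: "(real \<Rightarrow> real) \<Rightarrow> real \<Rightarrow> real \<Rightarrow> real" where
  "run_inf w s t = (INF u\<in>{s..t}. w u)"

definition run_sup :: "(real \<Rightarrow> real) \<Rightarrow> real \<Rightarrow> real \<Rightarrow> real" where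
  "run_sup w s t = (SUP u\<in>{s..t}. w u)"

text \<open>
  The conditions relating one of the two families \<open>U\<close> to \<open>W\<close>. The functional \<open>ext\<close> is
  \<^const>\<open>run_inf\<close> for \<open>U\<^sup>+\<close> and \<^const>\<open>run_sup\<close> for \<open>U\<^sup>-\<close>.
\<close>

definition (in prob_space) splitting_family ::
    "((real \<Rightarrow> real) \<Rightarrow> real \<Rightarrow> real \<Rightarrow> real) \<Rightarrow> real measure \<Rightarrow>
     (real \<Rightarrow> real \<Rightarrow> 'a \<Rightarrow> real) \<Rightarrow> (real \<Rightarrow> 'a \<Rightarrow> real) \<Rightarrow> bool" where
  "splitting_family ext m U W \<longleftrightarrow>
    (let Mx = (\<lambda>s t \<omega>. ext (\<lambda>u. W u \<omega>) s t) in
    (\<forall>s t. s \<le> t \<longrightarrow> U s t \<in> M \<rightarrow>\<^sub>M unit_interval) \<and>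
    (\<forall>s t. s < t \<longrightarrow>
      indep_rvs unit_interval (U s t) path_space (\<lambda>\<omega> u. W u \<omega>) \<and>
      distr M unit_interval (U s t) = m) \<and>
    (\<forall>s t u v. s < t \<longrightarrow> u < v \<longrightarrow>
      (AE \<omega> in M. Mx s t \<omega> = Mx u v \<omega> \<longrightarrow> U s t \<omega> = U u v \<omega>)) \<and>
    (\<forall>s t (n :: nat) a b. s < t \<longrightarrow> (\<forall>i<n. a i < b i) \<longrightarrow>
      (let G = vimage_algebra (space M)
                 (\<lambda>\<omega>. (\<lambda>i\<in>{..<n}. U (a i) (b i) \<omega>, \<lambda>u. W u \<omega>))
                 (Pi\<^sub>M {..<n} (\<lambda>_. unit_interval) \<Otimes>\<^sub>M path_space)
       in cond_law_on {\<omega>. Mx s t \<omega> \<notin> {Mx (a i) (b i) \<omega> | i. i < n}} G unit_interval (U s t) (\<lambda>_. m) \<and>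
          (\<forall>i<n. cond_law_on {\<omega>. Mx s t \<omega> = Mx (a i) (b i) \<omega>} G unit_interval (U s t)
             (\<lambda>\<omega>. return unit_interval (U (a i) (b i) \<omega>))))))"

locale driving_process = prob_space P
  for P :: "'a measure" and mp mm :: "real measure"
    and Up Um :: "real \<Rightarrow> real \<Rightarrow> 'a \<Rightarrow> real" and W :: "real \<Rightarrow> 'a \<Rightarrow> real" +
  assumes brownian: "two_sided_brownian_motion W"
    and cond_indep: "cond_indep_var (vimage_algebra (space P) (\<lambda>\<omega> u. W u \<omega>) path_space)
          (Pi\<^sub>M time_pairs (\<lambda>_. unit_interval)) (\<lambda>\<omega>. \<lambda>(s, t)\<in>time_pairs. Up s t \<omega>)
          (Pi\<^sub>M time_pairs (\<lambda>_. unit_interval)) (\<lambda>\<omega>. \<lambda>(s, t)\<in>time_pairs. Um s t \<omega>)"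
    and plus: "splitting_family run_inf mp Up W"
    and minus: "splitting_family run_sup mm Um W"

text \<open>
  The modification only replaces the values with \<open>s < t\<close>: for \<open>s = t\<close> the approximating pairs
  are not ordered, so the family is not constrained there.
\<close>

definition limsup_modification :: "(real \<Rightarrow> real \<Rightarrow> real) \<Rightarrow> real \<Rightarrow> real \<Rightarrow> real" where
  "limsup_modification u s t =
    (if s < t then real_of_ereal (limsup (\<lambda>n::nat.
       ereal (u ((of_int \<lfloor>real n * s\<rfloor> + 1) / real n) ((of_int \<lfloor>real n * t\<rfloor> - 1) / real n))))
     else u s t)"

section \<open>The flow of kernels, as a function of the path and the splitting parameters\<close>

text \<open>
  Here \<open>w\<close> is a path of \<open>W\<close>, and \<open>up\<close>, \<open>um\<close> are realisations of \<open>U\<^sup>+\<close>, \<open>U\<^sup>-\<close>. Hitting times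
  are extended reals, so that the infimum of the empty set is infinity.
\<close>

definition wplus :: "(real \<Rightarrow> real) \<Rightarrow> real \<Rightarrow> real \<Rightarrow> real" where
  "wplus w s t = w t - run_inf w s t"

definition wminus :: "(real \<Rightarrow> real) \<Rightarrow> real \<Rightarrow> real \<Rightarrow> real" where
  "wminus w s t = run_sup w s t - w t"

definition eps :: "real \<Rightarrow> complex \<Rightarrow> real" where
  "eps l z = (if Arg2pi z \<in> {0..l} then 1 else - 1)"

definition rho :: "real \<Rightarrow> (real \<Rightarrow> real) \<Rightarrow> ereal \<Rightarrow> ereal" where
  "rho l w s = Inf {ereal r | r. s \<le> ereal r \<and>
     max (wplus w (real_of_ereal s) r) (wminus w (real_of_ereal s) r) = l}"

definition moved :: "real \<Rightarrow> (real \<Rightarrow> real) \<Rightarrow> real \<Rightarrow> real \<Rightarrow> complex \<Rightarrow> complex" where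
  "moved l w s t z = z * cis (eps l z * (w t - w s))"

definition tau :: "real \<Rightarrow> (real \<Rightarrow> real) \<Rightarrow> real \<Rightarrow> complex \<Rightarrow> ereal" where
  "tau l w s z = Inf {ereal r | r. s \<le> r \<and> moved l w s r z \<in> {1, cis l}}"

text \<open>The measure \<open>u \<delta>\<^sub>x + (1 - u) \<delta>\<^sub>y\<close>.\<close>

definition two_point :: "real \<Rightarrow> complex \<Rightarrow> complex \<Rightarrow> complex measure" where
  "two_point u x y = measure_of (space circle_space) (sets circle_space)
     (\<lambda>A. ennreal u * emeasure (return circle_space x) A
        + ennreal (1 - u) * emeasure (return circle_space y) A)"

definition kernel_one ::
    "(real \<Rightarrow> real \<Rightarrow> real) \<Rightarrow> (real \<Rightarrow> real) \<Rightarrow> real \<Rightarrow> real \<Rightarrow> complex measure" where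
  "kernel_one up w s t = two_point (up s t) (cis (wplus w s t)) (cis (- wplus w s t))"

definition kernel_l ::
    "real \<Rightarrow> (real \<Rightarrow> real \<Rightarrow> real) \<Rightarrow> (real \<Rightarrow> real) \<Rightarrow> real \<Rightarrow> real \<Rightarrow> complex measure" where
  "kernel_l l um w s t = two_point (um s t) (cis (l + wminus w s t)) (cis (l - wminus w s t))"

text \<open>The kernel \<open>K\<^sub>s\<^sub>,\<^sub>t\<close> for \<open>s \<le> t \<le> \<rho>\<^sub>s\<close>; its values for other \<open>t\<close> are not used.\<close>

definition step_kernel ::
    "real \<Rightarrow> (real \<Rightarrow> real \<Rightarrow> real) \<Rightarrow> (real \<Rightarrow> real \<Rightarrow> real) \<Rightarrow> (real \<Rightarrow> real) \<Rightarrow>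
     real \<Rightarrow> real \<Rightarrow> complex \<Rightarrow> complex measure" where
  "step_kernel l up um w s t z =
    (if z = 1 then kernel_one up w s t
     else if z = cis l then kernel_l l um w s t
     else if ereal t \<le> tau l w s z then return circle_space (moved l w s t z)
     else if moved l w s (real_of_ereal (tau l w s z)) z = 1 then kernel_one up w s t
     else kernel_l l um w s t)"

definition kernel_comp ::
    "(complex \<Rightarrow> complex measure) \<Rightarrow> (complex \<Rightarrow> complex measure) \<Rightarrow> complex \<Rightarrow> complex measure" where
  "kernel_comp K1 K2 x = K1 x \<bind> K2"

definition rho_iter :: "real \<Rightarrow> (real \<Rightarrow> real) \<Rightarrow> real \<Rightarrow> nat \<Rightarrow> ereal" where
  "rho_iter l w s k = (rho l w ^^ k) (ereal s)"

text \<open>The product of the first \<open>k\<close> kernels between consecutive \<open>\<rho>\<close>-times (the identity kernel if \<open>k = 0\<close>).\<close>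

primrec chain_kernel ::
    "real \<Rightarrow> (real \<Rightarrow> real \<Rightarrow> real) \<Rightarrow> (real \<Rightarrow> real \<Rightarrow> real) \<Rightarrow> (real \<Rightarrow> real) \<Rightarrow>
     real \<Rightarrow> nat \<Rightarrow> complex \<Rightarrow> complex measure" where
  "chain_kernel l up um w s 0 = return circle_space"
| "chain_kernel l up um w s (Suc k) =
     kernel_comp (chain_kernel l up um w s k)
       (step_kernel l up um w (real_of_ereal (rho_iter l w s k)) (real_of_ereal (rho_iter l w s (Suc k))))"

definition path_flow_kernel ::
    "real \<Rightarrow> (real \<Rightarrow> real \<Rightarrow> real) \<Rightarrow> (real \<Rightarrow> real \<Rightarrow> real) \<Rightarrow> (real \<Rightarrow> real) \<Rightarrow>
     real \<Rightarrow> real \<Rightarrow> complex \<Rightarrow> complex measure" where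
  "path_flow_kernel l up um w s t z = measure_of (space circle_space) (sets circle_space)
     (\<lambda>A. \<Sum>k. indicator {k. rho_iter l w s k \<le> ereal t \<and> ereal t < rho_iter l w s (Suc k)} k *
        emeasure (kernel_comp (chain_kernel l up um w s k)
          (step_kernel l up um w (real_of_ereal (rho_iter l w s k)) t) z) A)"

definition flow_kernel ::
    "real \<Rightarrow> (real \<Rightarrow> real \<Rightarrow> 'a \<Rightarrow> real) \<Rightarrow> (real \<Rightarrow> real \<Rightarrow> 'a \<Rightarrow> real) \<Rightarrow> (real \<Rightarrow> 'a \<Rightarrow> real) \<Rightarrow>
     'a \<Rightarrow> real \<Rightarrow> real \<Rightarrow> complex \<Rightarrow> complex measure" where
  "flow_kernel l Up Um W \<omega> =
     path_flow_kernel l (limsup_modification (\<lambda>s t. Up s t \<omega>)) (limsup_modification (\<lambda>s t. Um s t \<omega>))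
       (\<lambda>t. W t \<omega>)"

end

(* Every one-step kernel maps a point to a measure carried by at most two points, and at most one
   term of the sum defining the flow is nonzero because the times rho^k are nondecreasing. Hence the
   kernel is carried by a finite set for every single path. The inner measures are handled without
   measurability of the kernels: a measure with prescribed values on preimages is either that set
   function or zero, and null sets of finite complement are preserved in both cases. *)

theory Submission
  imports Defs
begin

text \<open>A null complement passes through integrals more directly than a condition on open
  neighbourhoods, so this is the property carried through the induction;
  \<open>finite_measure_supp\<close> turns it into a statement about the support at the end.\<close>

definition finitely_carried :: "complex measure \<Rightarrow> bool" where
  "finitely_carried \<mu> \<longleftrightarrow> (\<exists>F. finite F \<and> emeasure \<mu> (unit_circle - F) = 0)"

lemma finitely_carriedI:
  "finite F \<Longrightarrow> emeasure \<mu> (unit_circle - F) = 0 \<Longrightarrow> finitely_carried \<mu>"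
  unfolding finitely_carried_def by blast

lemma space_circle_space: "space circle_space = unit_circle"
  by (simp add: space_restrict_space)

lemma circle_diff_finite_sets:
  assumes "finite F"
  shows "unit_circle - F \<in> sets circle_space"
proof -
  have "unit_circle - F \<in> sets borel"
    using assms by (intro sets.Diff borel_closed) (auto intro: finite_imp_closed)
  then show ?thesis
    by (auto simp: sets_restrict_space_iff)
qed

lemma finitely_carried_return: "finitely_carried (return circle_space x)"
  by (rule finitely_carriedI[of "{x}"]) (simp_all add: circle_diff_finite_sets)

lemma sets_two_point: "sets (two_point u x y) = sets circle_space"
  unfolding two_point_def by (rule sets.sets_measure_of_eq)

lemma finitely_carried_two_point: "finitely_carried (two_point u x y)"
proof (rule finitely_carriedI)
  \<comment> \<open>\<open>emeasure_measure_of_conv\<close> leaves the prescribed value or 0, so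
    countable additivity need not be checked. Both Dirac terms vanish off \<open>{x, y}\<close>,
    whatever the weight \<open>u\<close>.\<close>
  show "emeasure (two_point u x y) (unit_circle - {x, y}) = 0"
    unfolding two_point_def emeasure_measure_of_conv
    by (simp add: circle_diff_finite_sets)
qed simp

lemma sets_step_kernel: "sets (step_kernel l up um w s t z) = sets circle_space"
  unfolding step_kernel_def kernel_one_def kernel_l_def by (simp add: sets_two_point)

lemma finitely_carried_step_kernel: "finitely_carried (step_kernel l up um w s t z)"
  unfolding step_kernel_def kernel_one_def kernel_l_def
  by (simp add: finitely_carried_two_point finitely_carried_return)

text \<open>The image measure of \<open>A\<close> is either 0 or the outcome of
  \<open>emeasure M\<close> on the preimage. The latter is 0 by monotonicity, since only the larger
  set \<open>N\<close> must be measurable.\<close>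

lemma emeasure_distr_eq_0:
  assumes "N \<in> null_sets M" and "f -` A \<inter> space M \<subseteq> N"
  shows "emeasure (distr M L f) A = 0"
proof -
  have "emeasure M (f -` A \<inter> space M) = 0"
    using emeasure_mono[OF assms(2) null_setsD2[OF assms(1)]] null_setsD1[OF assms(1)] by simp
  then show ?thesis
    unfolding distr_def emeasure_measure_of_conv by simp
qed

text \<open>If \<open>F\<close> carries \<open>M\<close> and each \<open>G x\<close> carries
  \<open>K x\<close>, then the finite union of the \<open>G x\<close> over \<open>x\<close> in
  \<open>F\<close> carries the composition: starting points outside \<open>F\<close> form a null
  set.\<close>

lemma finitely_carried_bind:
  assumes sets_M: "sets M = sets circle_space" and M: "finitely_carried M"
    and sets_K: "\<And>x. sets (K x) = sets circle_space" and K: "\<And>x. finitely_carried (K x)"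
  shows "finitely_carried (M \<bind> K)"
proof -
  obtain F where F: "finite F" "emeasure M (unit_circle - F) = 0"
    using M unfolding finitely_carried_def by blast
  obtain G where G: "\<And>x. finite (G x)" "\<And>x. emeasure (K x) (unit_circle - G x) = 0"
    using K unfolding finitely_carried_def by metis
  define A where "A = unit_circle - \<Union>(G ` F)"
  have fin: "finite (\<Union>(G ` F))"
    using F(1) G(1) by blast
  have A: "A \<in> sets circle_space"
    unfolding A_def by (rule circle_diff_finite_sets[OF fin])
  have space_M: "space M = unit_circle"
    using sets_eq_imp_space_eq[OF sets_M] by (simp add: space_circle_space)
  have ne: "space M \<noteq> {}"
    by (simp add: space_M)
  have K_A: "emeasure (K x) A = 0" if "x \<in> F" for x
  proof -
    have "emeasure (K x) A \<le> emeasure (K x) (unit_circle - G x)"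
      using that G(1) by (intro emeasure_mono) (auto simp: A_def sets_K circle_diff_finite_sets)
    then show ?thesis using G(2)[of x] by simp
  qed
  define D where "D = distr M (subprob_algebra circle_space) K"
  \<comment> \<open>\<open>bind\<close> takes its target algebra from \<open>K\<close> at an
    arbitrarily chosen point; this equality makes that choice irrelevant.\<close>
  have "subprob_algebra (K x) = subprob_algebra circle_space" for x
    by (rule subprob_algebra_cong[OF sets_K])
  then have bind: "M \<bind> K = join D"
    unfolding D_def using ne by (simp add: bind_nonempty)
  have sets_D: "sets D = sets (subprob_algebra circle_space)"
    by (simp add: D_def)
  \<comment> \<open>Evaluation at \<open>A\<close> is measurable on \<open>subprob_algebra\<close>
    by construction, independently of \<open>K\<close>.\<close>
  have meas: "(\<lambda>\<mu>. emeasure \<mu> A) \<in> borel_measurable D"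
    using measurable_emeasure_subprob_algebra[OF A] sets_D
    by (simp cong: measurable_cong_sets)
  \<comment> \<open>By \<open>K_A\<close>, the preimage of this set under \<open>K\<close> avoids
    \<open>F\<close>, so it lies in a null set of \<open>M\<close>.\<close>
  have "emeasure D {\<mu> \<in> space D. emeasure \<mu> A \<noteq> 0} = 0"
    unfolding D_def
  proof (rule emeasure_distr_eq_0)
    show "unit_circle - F \<in> null_sets M"
      using F by (simp add: null_sets_def sets_M circle_diff_finite_sets)
  qed (use K_A in \<open>auto simp: space_M\<close>)
  then have "(\<integral>\<^sup>+ \<mu>. emeasure \<mu> A \<partial>D) = 0"
    using meas by (simp add: nn_integral_0_iff)
  then have "emeasure (M \<bind> K) A = 0"
    by (simp add: bind emeasure_join[OF sets_D A])
  then show ?thesis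
    using fin unfolding A_def by (rule finitely_carriedI[rotated])
qed

lemma sets_chain_kernel: "sets (chain_kernel l up um w s k z) = sets circle_space"
proof (induction k)
  case (Suc k)
  have "space (chain_kernel l up um w s k z) \<noteq> {}"
    using sets_eq_imp_space_eq[OF Suc] by (simp add: space_circle_space)
  then show ?case
    by (simp add: kernel_comp_def sets_bind[OF sets_step_kernel])
qed simp

lemma finitely_carried_chain_kernel: "finitely_carried (chain_kernel l up um w s k z)"
proof (induction k)
  case (Suc k)
  then show ?case
    by (simp add: kernel_comp_def finitely_carried_bind sets_chain_kernel sets_step_kernel
        finitely_carried_step_kernel)
qed (simp add: finitely_carried_return)

lemma rho_ge: "s \<le> rho l w s"
  unfolding rho_def by (rule Inf_greatest) auto

lemma mono_rho_iter: "mono (rho_iter l w s)"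
  unfolding mono_iff_le_Suc by (simp add: rho_iter_def rho_ge)

lemma rho_iter_interval_unique:
  assumes "rho_iter l w s j \<le> t" "t < rho_iter l w s (Suc j)"
    and "rho_iter l w s k \<le> t" "t < rho_iter l w s (Suc k)"
  shows "j = k"
proof -
  \<comment> \<open>Otherwise monotonicity would put the time of index \<open>i'\<close> at or above
    that of \<open>Suc i\<close>, hence beyond \<open>t\<close>.\<close>
  have "\<not> Suc i \<le> i'" if "rho_iter l w s i' \<le> t" "t < rho_iter l w s (Suc i)" for i i'
    using monoD[OF mono_rho_iter, of "Suc i" i' l w s] that by auto
  then show ?thesis
    using assms by (meson Suc_leI linorder_neqE_nat)
qed

lemma finitely_carried_path_flow_kernel: "finitely_carried (path_flow_kernel l up um w s t z)"
proof -
  define S where "S = {k. rho_iter l w s k \<le> ereal t \<and> ereal t < rho_iter l w s (Suc k)}"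
  define K where "K k = kernel_comp (chain_kernel l up um w s k)
    (step_kernel l up um w (real_of_ereal (rho_iter l w s k)) t) z" for k
  have K: "finitely_carried (K k)" for k
    unfolding K_def kernel_comp_def
    by (intro finitely_carried_bind sets_chain_kernel sets_step_kernel
        finitely_carried_chain_kernel finitely_carried_step_kernel)
  have uniq: "j = k" if "j \<in> S" "k \<in> S" for j k
    using that rho_iter_interval_unique unfolding S_def by blast
  \<comment> \<open>One \<open>F\<close> serves all of \<open>S\<close>, which has at most one
    element. For empty \<open>S\<close> any finite set will do, and the sum defining the kernel is
    then 0.\<close>
  obtain F where F: "finite F" "\<And>k. k \<in> S \<Longrightarrow> emeasure (K k) (unit_circle - F) = 0"
  proof (cases "S = {}")
    case False
    then obtain k where "k \<in> S" by blast
    moreover obtain F where "finite F" "emeasure (K k) (unit_circle - F) = 0"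
      using K[of k] unfolding finitely_carried_def by blast
    ultimately show ?thesis
      using that uniq by blast
  qed auto
  have "(\<lambda>k. indicator S k * emeasure (K k) (unit_circle - F)) = (\<lambda>_. 0)"
    using F(2) by (auto simp: indicator_def)
  then have "emeasure (path_flow_kernel l up um w s t z) (unit_circle - F) = 0"
    unfolding path_flow_kernel_def emeasure_measure_of_conv S_def K_def by simp
  with F(1) show ?thesis
    by (rule finitely_carriedI)
qed

text \<open>The complement of a finite carrying set is open and null, so it is a neighbourhood
  excluding each of its points from the support.\<close>

lemma finite_measure_supp:
  assumes "space \<mu> = unit_circle" and "finitely_carried \<mu>"
  shows "finite (measure_supp \<mu>)"
proof -
  obtain F where F: "finite F" "emeasure \<mu> (unit_circle - F) = 0"
    using assms(2) unfolding finitely_carried_def by blast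
  have "x \<in> F" if "x \<in> measure_supp \<mu>" for x
  proof (rule ccontr)
    assume "x \<notin> F"
    moreover have "open (- F)"
      using F(1) by (simp add: finite_imp_closed open_Compl)
    ultimately have "emeasure \<mu> (- F \<inter> unit_circle) > 0"
      using that unfolding measure_supp_def assms(1) by blast
    moreover have "- F \<inter> unit_circle = unit_circle - F" by blast
    ultimately show False using F(2) by simp
  qed
  then show ?thesis
    using F(1) by (meson finite_subset subsetI)
qed

theorem mainTheorem5:
  fixes l :: real and mp mm :: "real measure" and P :: "'a measure"
    and Up Um :: "real \<Rightarrow> real \<Rightarrow> 'a \<Rightarrow> real" and W :: "real \<Rightarrow> 'a \<Rightarrow> real"
  assumes "0 < l" and "l \<le> pi"
    and "prob_space mp" and "sets mp = sets unit_interval" and "(\<integral>x. x \<partial>mp) = 1 / 2"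
    and "prob_space mm" and "sets mm = sets unit_interval" and "(\<integral>x. x \<partial>mm) = 1 / 2"
    and "driving_process P mp mm Up Um W"
  shows "AE \<omega> in P. \<forall>z\<in>unit_circle. \<forall>t\<ge>0. finite (measure_supp (flow_kernel l Up Um W \<omega> 0 t z))"
proof -
  have "space (flow_kernel l Up Um W \<omega> 0 t z) = unit_circle" for \<omega> t z
    unfolding flow_kernel_def path_flow_kernel_def sets.space_measure_of_eq
    by (rule space_circle_space)
  \<comment> \<open>The bound is available pointwise in the sample, simultaneously for all
    \<open>t\<close> and \<open>z\<close>, so no exceptional null sets have to be combined.\<close>
  moreover have "finitely_carried (flow_kernel l Up Um W \<omega> 0 t z)" for \<omega> t z
    unfolding flow_kernel_def by (rule finitely_carried_path_flow_kernel)
  ultimately show ?thesis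
    by (simp add: finite_measure_supp)
qed

end
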